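(* If $G$ is a block graph with $n(G)\ge 3$ vertices, then $\dim_{n\ell}(G)=\dim(\widehat{G})$, where $\widehat{G}$ is the block-cutpoint tree of $G$.
   Context: Graphs are finite, simple and connected; $d_G(u,v)$ is the shortest-path distance and $n(G)$ the number of vertices. A set $X\subseteq V(G)$ resolves two vertices $u,v$ if some $x\in X$ satisfies $d_G(u,x)\neq d_G(v,x)$. $X$ is a resolving set if it resolves every pair of distinct vertices; the metric dimension $\dim(G)$ is the minimum size of a resolving set (in particular $\dim(K_1)=0$). $X$ is a nonlocal resolving set if it resolves every pair of distinct non-adjacent vertices; the nonlocal metric dimension $\dim_{n\ell}(G)$ is the minimum size of a nonlocal resolving set. A block of $G$ is a maximal connected subgraph without a cut-vertex; a block graph is a connected graph in which every block is a complete graph. The block-cutpoint tree $\widehat{G}$ is the tree whose vertex set consists of the blocks and the cut-vertices of $G$, where a block $B$ is adjacent to a cut-vertex $v$ iff $v\in V(B)$ (if $G$ has no cut-vertex, $\widehat G=K_1$). *)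

theory Defs
  imports Main
begin

definition restr :: "('a \<Rightarrow> 'a \<Rightarrow> bool) \<Rightarrow> 'a set \<Rightarrow> 'a \<Rightarrow> 'a \<Rightarrow> bool" where
  "restr E S = (\<lambda>x y. E x y \<and> x \<in> S \<and> y \<in> S)"

definition connected_on :: "('a \<Rightarrow> 'a \<Rightarrow> bool) \<Rightarrow> 'a set \<Rightarrow> bool" where
  "connected_on E S \<longleftrightarrow> (\<forall>u\<in>S. \<forall>v\<in>S. (restr E S)\<^sup>*\<^sup>* u v)"

definition graph :: "'a set \<Rightarrow> ('a \<Rightarrow> 'a \<Rightarrow> bool) \<Rightarrow> bool" where
  "graph V E \<longleftrightarrow> finite V \<and> V \<noteq> {} \<and>
     (\<forall>x y. E x y \<longrightarrow> x \<in> V \<and> y \<in> V) \<and>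
     (\<forall>x y. E x y \<longrightarrow> E y x) \<and> (\<forall>x. \<not> E x x) \<and> connected_on E V"

definition gdist :: "('a \<Rightarrow> 'a \<Rightarrow> bool) \<Rightarrow> 'a \<Rightarrow> 'a \<Rightarrow> nat" where
  "gdist E u v = (LEAST n. (E ^^ n) u v)"

definition resolves :: "('a \<Rightarrow> 'a \<Rightarrow> bool) \<Rightarrow> 'a set \<Rightarrow> 'a \<Rightarrow> 'a \<Rightarrow> bool" where
  "resolves E X u v \<longleftrightarrow> (\<exists>x\<in>X. gdist E u x \<noteq> gdist E v x)"

definition resolving_set :: "'a set \<Rightarrow> ('a \<Rightarrow> 'a \<Rightarrow> bool) \<Rightarrow> 'a set \<Rightarrow> bool" where
  "resolving_set V E X \<longleftrightarrow> X \<subseteq> V \<and>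
     (\<forall>u\<in>V. \<forall>v\<in>V. u \<noteq> v \<longrightarrow> resolves E X u v)"

definition nonlocal_resolving_set :: "'a set \<Rightarrow> ('a \<Rightarrow> 'a \<Rightarrow> bool) \<Rightarrow> 'a set \<Rightarrow> bool" where
  "nonlocal_resolving_set V E X \<longleftrightarrow> X \<subseteq> V \<and>
     (\<forall>u\<in>V. \<forall>v\<in>V. u \<noteq> v \<and> \<not> E u v \<longrightarrow> resolves E X u v)"

definition metric_dim :: "'a set \<Rightarrow> ('a \<Rightarrow> 'a \<Rightarrow> bool) \<Rightarrow> nat" where
  "metric_dim V E = (LEAST k. \<exists>X. resolving_set V E X \<and> card X = k)"

definition nonlocal_metric_dim :: "'a set \<Rightarrow> ('a \<Rightarrow> 'a \<Rightarrow> bool) \<Rightarrow> nat" where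
  "nonlocal_metric_dim V E = (LEAST k. \<exists>X. nonlocal_resolving_set V E X \<and> card X = k)"

definition cut_vertex :: "'a set \<Rightarrow> ('a \<Rightarrow> 'a \<Rightarrow> bool) \<Rightarrow> 'a \<Rightarrow> bool" where
  "cut_vertex V E v \<longleftrightarrow> v \<in> V \<and> \<not> connected_on E (V - {v})"

definition nonseparable :: "('a \<Rightarrow> 'a \<Rightarrow> bool) \<Rightarrow> 'a set \<Rightarrow> bool" where
  "nonseparable E B \<longleftrightarrow> B \<noteq> {} \<and> connected_on E B \<and> (\<forall>v\<in>B. connected_on E (B - {v}))"

text \<open>Blocks (identified with their vertex sets; maximal such subgraphs are induced).\<close>
definition is_block :: "'a set \<Rightarrow> ('a \<Rightarrow> 'a \<Rightarrow> bool) \<Rightarrow> 'a set \<Rightarrow> bool" where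
  "is_block V E B \<longleftrightarrow> B \<subseteq> V \<and> nonseparable E B \<and>
     (\<forall>C. B \<subset> C \<and> C \<subseteq> V \<longrightarrow> \<not> nonseparable E C)"

definition clique :: "('a \<Rightarrow> 'a \<Rightarrow> bool) \<Rightarrow> 'a set \<Rightarrow> bool" where
  "clique E B \<longleftrightarrow> (\<forall>x\<in>B. \<forall>y\<in>B. x \<noteq> y \<longrightarrow> E x y)"

definition block_graph :: "'a set \<Rightarrow> ('a \<Rightarrow> 'a \<Rightarrow> bool) \<Rightarrow> bool" where
  "block_graph V E \<longleftrightarrow> graph V E \<and> (\<forall>B. is_block V E B \<longrightarrow> clique E B)"

definition bc_vertices :: "'a set \<Rightarrow> ('a \<Rightarrow> 'a \<Rightarrow> bool) \<Rightarrow> ('a set + 'a) set" where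
  "bc_vertices V E = Inl ` {B. is_block V E B} \<union> Inr ` {v. cut_vertex V E v}"

definition bc_edge :: "'a set \<Rightarrow> ('a \<Rightarrow> 'a \<Rightarrow> bool) \<Rightarrow> ('a set + 'a) \<Rightarrow> ('a set + 'a) \<Rightarrow> bool" where
  "bc_edge V E x y \<longleftrightarrow>
     (\<exists>B v. is_block V E B \<and> cut_vertex V E v \<and> v \<in> B \<and>
        ((x = Inl B \<and> y = Inr v) \<or> (x = Inr v \<and> y = Inl B)))"

end

theory Submission
  imports Defs
begin

text \<open>
  Deleting the edges inside a block \<open>B\<close> of a block graph puts the vertices of \<open>B\<close> into different
  components, so every vertex \<open>x\<close> has a unique gate in \<open>B\<close>, and a geodesic between vertices with
  different gates passes through both gates. Hence twice the distance from a vertex \<open>v\<close> to a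
  block or a cut-vertex \<open>y\<close> gives, up to a constant depending only on \<open>y\<close>, the distance between
  \<open>v\<close> and \<open>y\<close> in the tree.

  A nonlocal resolving set \<open>X\<close> is sent to the tree by replacing each vertex that is not a
  cut-vertex by its block. If two nodes of the tree of the same colour are not resolved, then
  stepping away from each of them gives two nonadjacent vertices that \<open>X\<close> does not resolve; nodes
  of different colours are resolved by parity.

  Conversely, a resolving set \<open>Y\<close> of the tree resolves all nonadjacent pairs of vertices, since
  moving one step towards each other turns an unresolved nonadjacent pair into an unresolved pair
  of blocks. A block in \<open>Y\<close> may be replaced by any of its vertices that is not a cut-vertex. If it
  consists of cut-vertices, then at most one of the branches at it avoids the rest of \<open>Y\<close>, and it
  may be replaced by the vertex in that branch.
\<close>

section \<open>Walks\<close>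

lemma rtranclp_reverse:
  assumes "\<And>x y. R x y \<Longrightarrow> R y x" "R\<^sup>*\<^sup>* x y"
  shows "R\<^sup>*\<^sup>* y x"
  using assms(2) by induction (auto intro: assms(1) converse_rtranclp_into_rtranclp)

lemma rtranclp_segment:
  assumes "i \<le> j" "\<And>k. i \<le> k \<Longrightarrow> k < j \<Longrightarrow> R (f k) (f (Suc k))"
  shows "R\<^sup>*\<^sup>* (f i) (f j)"
  using assms by (induction j rule: dec_induct) (auto intro: rtranclp.rtrancl_into_rtrancl)

lemma relpowp_segment:
  assumes "i \<le> j" "\<And>k. i \<le> k \<Longrightarrow> k < j \<Longrightarrow> R (f k) (f (Suc k))"
  shows "(R ^^ (j - i)) (f i) (f j)"
  unfolding relpowp_fun_conv using assms by (intro exI[of _ "\<lambda>k. f (i + k)"]) auto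

lemma gdist_le: "(R ^^ n) u v \<Longrightarrow> gdist R u v \<le> n"
  unfolding gdist_def by (rule Least_le)

text \<open>The Lipschitz bound forces every walk from \<open>a\<close> to \<open>y\<close> to have
  length at least \<open>h a\<close>; descending \<open>h\<close> inside \<open>P\<close> builds a
  walk of exactly that length.\<close>

lemma gdist_eqI:
  assumes zero: "h y = 0"
    and lipschitz: "\<And>a b. R a b \<Longrightarrow> h a \<le> h b + 1"
    and descent: "\<And>a. P a \<Longrightarrow> a \<noteq> y \<Longrightarrow> \<exists>b. R a b \<and> P b \<and> h a = h b + (1::nat)"
    and "P a"
  shows "gdist R a y = h a"
proof -
  have le: "h a \<le> n" if "(R ^^ n) a y" for a n
    using that
  proof (induction n arbitrary: a)
    case 0
    then show ?case using zero by simp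
  next
    case (Suc n)
    then obtain b where "R a b" "(R ^^ n) b y" by (meson relpowp_Suc_D2)
    then show ?case using Suc.IH lipschitz[of a b] by fastforce
  qed
  have walk: "(R ^^ h a) a y" if "P a" for a
    using that
  proof (induction "h a" arbitrary: a)
    case 0
    then show ?case using descent[of a] by fastforce
  next
    case (Suc n)
    then have "a \<noteq> y" using zero by auto
    then obtain b where b: "R a b" "P b" "h a = h b + 1" using descent Suc.prems by blast
    then have "(R ^^ h b) b y" using Suc.hyps by simp
    then show ?case using b by (simp add: relpowp_Suc_I2 del: relpowp.simps)
  qed
  show ?thesis
    unfolding gdist_def using le walk[OF \<open>P a\<close>] by (intro Least_equality) auto
qed

section \<open>Blocks as gated sets\<close>

locale nontrivial_block_graph =
  fixes V :: "'a set" and E :: "'a \<Rightarrow> 'a \<Rightarrow> bool"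
  assumes block_graph: "block_graph V E" and card_ge: "card V \<ge> 2"
begin

abbreviation "d \<equiv> gdist E"
abbreviation "blk \<equiv> is_block V E"
abbreviation "cutv \<equiv> cut_vertex V E"

lemma finite_V: "finite V"
  and E_in_V: "E x y \<Longrightarrow> x \<in> V" "E x y \<Longrightarrow> y \<in> V"
  and E_sym: "E x y \<Longrightarrow> E y x"
  and E_irrefl: "\<not> E x x"
  and connected_V: "connected_on E V"
  using block_graph unfolding block_graph_def graph_def by blast+

lemma E_neq: "E x y \<Longrightarrow> x \<noteq> y"
  using E_irrefl by blast

lemma blk_adj: "blk B \<Longrightarrow> x \<in> B \<Longrightarrow> y \<in> B \<Longrightarrow> x \<noteq> y \<Longrightarrow> E x y"
  using block_graph unfolding block_graph_def clique_def by blast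

lemma blk_in_V: "blk B \<Longrightarrow> x \<in> B \<Longrightarrow> x \<in> V"
  unfolding is_block_def by blast

lemma restr_sym: "restr E S x y \<Longrightarrow> restr E S y x"
  unfolding restr_def using E_sym by blast

lemma reach: "u \<in> V \<Longrightarrow> v \<in> V \<Longrightarrow> E\<^sup>*\<^sup>* u v"
  using connected_V unfolding connected_on_def
  by (metis (mono_tags, lifting) restr_def mono_rtranclp)

lemma gdist_walk: "u \<in> V \<Longrightarrow> v \<in> V \<Longrightarrow> (E ^^ d u v) u v"
  unfolding gdist_def using reach by (metis LeastI_ex rtranclp_power)

lemma gdist_refl [simp]: "d u u = 0"
  using gdist_le[of 0 E u u] by simp

lemma gdist_eq_0: "u \<in> V \<Longrightarrow> v \<in> V \<Longrightarrow> d u v = 0 \<longleftrightarrow> u = v"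
  using gdist_walk[of u v] by auto

lemma gdist_triangle: "u \<in> V \<Longrightarrow> v \<in> V \<Longrightarrow> w \<in> V \<Longrightarrow> d u w \<le> d u v + d v w"
  by (metis gdist_le gdist_walk relpowp_trans)

lemma gdist_adj: "E u v \<Longrightarrow> d u v = 1"
  using gdist_le[of 1 E u v] gdist_eq_0[of u v] E_in_V[of u v] E_neq[of u v]
  by (simp add: eq_OO)

lemma gdist_step:
  assumes "u \<in> V" "v \<in> V" "u \<noteq> v"
  obtains w where "E u w" "d u v = d w v + 1"
proof -
  obtain m where m: "d u v = Suc m" using gdist_eq_0 assms by (metis not0_implies_Suc)
  then obtain w where w: "E u w" "(E ^^ m) w v"
    using gdist_walk[OF assms(1,2)] by (metis relpowp_Suc_D2)
  moreover have "d u v \<le> d u w + d w v"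
    using gdist_triangle assms w E_in_V by blast
  ultimately show ?thesis using that gdist_adj gdist_le[of m E w v] m by fastforce
qed

lemma exists_neighbour:
  assumes "v \<in> V" obtains u where "E v u"
proof -
  obtain w where "w \<in> V" "w \<noteq> v"
    using card_ge assms
    by (metis card_1_singleton_iff card_le_Suc0_iff_eq finite_V not_less_eq_eq numeral_2_eq_2)
  then show ?thesis using gdist_step assms that by metis
qed

section \<open>Existence and size of blocks\<close>

lemma nonseparable_edge: "E x y \<Longrightarrow> nonseparable E {x, y}"
proof -
  assume "E x y"
  then have r: "restr E {x, y} x y" "restr E {x, y} y x"
    using E_sym unfolding restr_def by auto
  have "connected_on E {x, y}"
    unfolding connected_on_def using r by auto
  moreover have "connected_on E ({x, y} - {v})" if "v \<in> {x, y}" for v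
    using that unfolding connected_on_def by auto
  ultimately show ?thesis unfolding nonseparable_def by blast
qed

lemma nonseparable_in_blk:
  assumes "nonseparable E S" "S \<subseteq> V"
  obtains B where "blk B" "S \<subseteq> B"
proof -
  let ?F = "{C. nonseparable E C \<and> S \<subseteq> C \<and> C \<subseteq> V}"
  have "finite ?F" using finite_V by (auto intro: finite_subset[of _ "Pow V"])
  moreover have "S \<in> ?F" using assms by blast
  ultimately obtain B where "B \<in> ?F" "\<forall>C\<in>?F. B \<subseteq> C \<longrightarrow> B = C"
    by (metis (no_types, lifting) finite_has_maximal empty_iff)
  then show ?thesis using that[of B] unfolding is_block_def by blast
qed

lemma edge_in_blk:
  assumes "E x y" obtains B where "blk B" "x \<in> B" "y \<in> B"
proof -
  have "{x, y} \<subseteq> V" using E_in_V[OF assms] by simp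
  then obtain B where "blk B" "{x, y} \<subseteq> B"
    using nonseparable_in_blk nonseparable_edge[OF assms] by metis
  then show ?thesis using that by simp
qed

lemma blk_nonempty: "blk B \<Longrightarrow> B \<noteq> {}"
  unfolding is_block_def nonseparable_def by blast

text \<open>A block with a single vertex would be properly contained in an edge, which is
  nonseparable.\<close>

lemma blk_other:
  assumes "blk B" obtains u where "u \<in> B" "u \<noteq> w"
proof (rule ccontr)
  assume "\<not> thesis"
  then have B: "B = {w}" using that blk_nonempty[OF assms] by blast
  then obtain u where u: "E w u" using exists_neighbour blk_in_V[OF assms] by blast
  then have "nonseparable E {w, u}" "B \<subset> {w, u}" "{w, u} \<subseteq> V"
    using nonseparable_edge[OF u] B E_neq[OF u] E_in_V[OF u] by auto
  then show False using assms unfolding is_block_def by blast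
qed

section \<open>Components left by deleting the edges of a block, and gates\<close>

definition off_edge :: "'a set \<Rightarrow> 'a \<Rightarrow> 'a \<Rightarrow> bool" where
  "off_edge B x y \<longleftrightarrow> E x y \<and> \<not> (x \<in> B \<and> y \<in> B)"

lemma off_edge_sym: "off_edge B x y \<Longrightarrow> off_edge B y x"
  unfolding off_edge_def using E_sym by blast

text \<open>A shortest walk between distinct vertices of a block that avoids the edges of the block
  is an ear, and adding an ear to a block keeps it nonseparable.\<close>

lemma blk_off_separated:
  assumes B: "blk B" and "a0 \<in> B" "b0 \<in> B" "(off_edge B)\<^sup>*\<^sup>* a0 b0"
  shows "a0 = b0"
proof (rule ccontr)
  assume "a0 \<noteq> b0"
  let ?R = "off_edge B"
  \<comment> \<open>The least such \<open>n\<close> makes the walk a path that meets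
    \<open>B\<close> only at its ends.\<close>
  define P where "P n \<longleftrightarrow> (\<exists>a\<in>B. \<exists>b\<in>B. a \<noteq> b \<and> (?R ^^ n) a b)" for n
  have "\<exists>n. P n" using assms \<open>a0 \<noteq> b0\<close> unfolding P_def by (meson rtranclp_power)
  then obtain n where Pn: "P n" and least: "\<And>m. m < n \<Longrightarrow> \<not> P m"
    by (metis exists_least_iff)
  have min: "x = y" if "(?R ^^ m) x y" "m < n" "x \<in> B" "y \<in> B" for m x y
    using least[OF that(2)] that unfolding P_def by auto
  obtain a b f where ab: "a \<in> B" "b \<in> B" "a \<noteq> b" and f: "f 0 = a" "f n = b"
    and step: "\<And>i. i < n \<Longrightarrow> ?R (f i) (f (Suc i))"
    using Pn unfolding P_def relpowp_fun_conv by blast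
  have seg: "(?R ^^ (j - i)) (f i) (f j)" if "i \<le> j" "j \<le> n" for i j
    using relpowp_segment[of i j ?R f] step that by simp
  have interior: "f i \<notin> B" if "0 < i" "i < n" for i
  proof
    assume "f i \<in> B"
    have "(?R ^^ i) a (f i)" "(?R ^^ (n - i)) (f i) b" using seg[of 0 i] seg[of i n] that f by auto
    then have "a = f i" "f i = b"
      using min[of i a "f i"] min[of "n - i" "f i" b] \<open>f i \<in> B\<close> ab that by auto
    then show False using ab by simp
  qed
  have inj: "i = j" if "f i = f j" "i \<le> j" "j \<le> n" for i j
  proof (rule ccontr)
    assume "i \<noteq> j"
    have "(?R ^^ (i + (n - j))) a b"
      using seg[of 0 i] seg[of j n] that f relpowp_trans[of i ?R a "f i" "n - j" b] by simp
    moreover have "i + (n - j) < n" using \<open>i \<noteq> j\<close> that by linarith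
    ultimately show False using min ab by blast
  qed
  define C where "C = B \<union> f ` {..n}"
  have n2: "n \<ge> 2"
  proof (rule ccontr)
    assume "\<not> n \<ge> 2"
    then have "n = 0 \<or> n = 1" by auto
    then show False using f ab step[of 0] unfolding off_edge_def by auto
  qed
  have fE: "E (f i) (f (Suc i))" if "i < n" for i using step[OF that] unfolding off_edge_def by blast
  have "f i \<in> V" if "i \<le> n" for i
    using that f ab blk_in_V[OF B] fE E_in_V by (metis le_eq_less_or_eq)
  then have CV: "C \<subseteq> V" using blk_in_V[OF B] unfolding C_def by auto
  have BC: "B \<subset> C" using interior[of 1] n2 unfolding C_def by force
  \<comment> \<open>Letting \<open>N\<close> be empty or a singleton treats connectedness and the
    absence of cut-vertices together.\<close>
  have conn: "connected_on E (C - N)" if N: "N \<subseteq> {v}" for N v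
  proof -
    let ?S = "restr E (C - N)"
    have to_B: "\<exists>z\<in>B - N. ?S\<^sup>*\<^sup>* x z" if x: "x \<in> C - N" for x
    proof (cases "x \<in> B")
      case True
      then show ?thesis using x by blast
    next
      case False
      then obtain i where i: "i \<le> n" "x = f i" using x unfolding C_def by auto
      \<comment> \<open>Follow the ear back to \<open>a\<close> if that part avoids
        \<open>N\<close>. Otherwise the deleted vertex lies before \<open>f i\<close>, and by
        injectivity the part from \<open>f i\<close> on to \<open>b\<close> avoids it.\<close>
      show ?thesis
      proof (cases "\<forall>k\<le>i. f k \<notin> N")
        case True
        have "?S (f k) (f (Suc k))" if "k < i" for k
          using True that i fE[of k] unfolding restr_def C_def by auto
        then have "?S\<^sup>*\<^sup>* (f 0) (f i)" by (intro rtranclp_segment) auto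
        then have "?S\<^sup>*\<^sup>* x a" using rtranclp_reverse[of ?S, OF restr_sym] i f by blast
        then show ?thesis using True f ab by fastforce
      next
        case False
        then obtain k where k: "k \<le> i" "f k \<in> N" by blast
        have up: "f l \<notin> N" if "i \<le> l" "l \<le> n" for l
        proof
          assume "f l \<in> N"
          then have "f k = f l" using k N by blast
          then have "k = l" using inj k that by auto
          then show False using k i x that by auto
        qed
        have "?S (f k) (f (Suc k))" if "i \<le> k" "k < n" for k
          using up[of k] up[of "Suc k"] that i fE[of k] unfolding restr_def C_def by auto
        then have "?S\<^sup>*\<^sup>* (f i) (f n)" using i by (intro rtranclp_segment) auto
        then show ?thesis using up[of n] i f ab by auto
      qed
    qed
    have "?S\<^sup>*\<^sup>* x y" if xy: "x \<in> C - N" "y \<in> C - N" for x y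
    proof -
      obtain z z' where z: "z \<in> B - N" "?S\<^sup>*\<^sup>* x z" "z' \<in> B - N" "?S\<^sup>*\<^sup>* y z'"
        using to_B xy by meson
      have "?S\<^sup>*\<^sup>* z z'"
        using z blk_adj[OF B, of z z'] BC unfolding restr_def by (cases "z = z'") auto
      moreover have "?S\<^sup>*\<^sup>* z' y" using rtranclp_reverse[of ?S, OF restr_sym] z by blast
      ultimately show ?thesis using z by (meson rtranclp_trans)
    qed
    then show ?thesis unfolding connected_on_def by blast
  qed
  have "nonseparable E C"
    using conn[of "{}"] conn[OF subset_refl] ab BC unfolding nonseparable_def by auto
  then show False using B BC CV unfolding is_block_def by blast
qed

text \<open>For \<open>x\<close> in \<open>V\<close> this vertex exists by \<open>gate_props\<close>
  and is unique by \<open>blk_off_separated\<close>. It is the vertex of \<open>B\<close> nearest to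
  \<open>x\<close>, see \<open>pdist_blk\<close>.\<close>

definition gate :: "'a set \<Rightarrow> 'a \<Rightarrow> 'a" where
  "gate B x = (THE w. w \<in> B \<and> (off_edge B)\<^sup>*\<^sup>* w x)"

lemma gate_eqI:
  assumes "blk B" "w \<in> B" "(off_edge B)\<^sup>*\<^sup>* w x"
  shows "gate B x = w"
  unfolding gate_def
proof (rule the_equality)
  fix w' assume "w' \<in> B \<and> (off_edge B)\<^sup>*\<^sup>* w' x"
  moreover have "(off_edge B)\<^sup>*\<^sup>* x w"
    using assms rtranclp_reverse[of "off_edge B", OF off_edge_sym] by blast
  ultimately show "w' = w" using blk_off_separated assms by (meson rtranclp_trans)
qed (use assms in blast)

lemma gate_self: "blk B \<Longrightarrow> w \<in> B \<Longrightarrow> gate B w = w"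
  by (rule gate_eqI) auto

text \<open>Follow a walk from a vertex of \<open>B\<close> to \<open>x\<close>: an edge inside
  \<open>B\<close> ends at a new candidate, and every other edge extends the \<open>off_edge\<close>
  walk.\<close>

lemma gate_props:
  assumes B: "blk B" and "x \<in> V"
  shows "gate B x \<in> B" "(off_edge B)\<^sup>*\<^sup>* (gate B x) x"
proof -
  obtain b where "b \<in> B" using blk_nonempty B by blast
  then have "E\<^sup>*\<^sup>* b x" using reach blk_in_V B assms by blast
  then have "\<exists>w\<in>B. (off_edge B)\<^sup>*\<^sup>* w x"
  proof induction
    case base
    then show ?case using \<open>b \<in> B\<close> by blast
  next
    case (step y z)
    then show ?case
      by (metis off_edge_def rtranclp.simps)
  qed
  then show "gate B x \<in> B" "(off_edge B)\<^sup>*\<^sup>* (gate B x) x"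
    using gate_eqI[OF B] by auto
qed

lemma gate_in_V: "blk B \<Longrightarrow> x \<in> V \<Longrightarrow> gate B x \<in> V"
  using gate_props blk_in_V by blast

lemma gate_adj:
  assumes "blk B" "E x y" "\<not> (x \<in> B \<and> y \<in> B)"
  shows "gate B x = gate B y"
proof -
  have "off_edge B x y" using assms unfolding off_edge_def by blast
  then have "(off_edge B)\<^sup>*\<^sup>* (gate B x) y"
    using gate_props[OF assms(1) E_in_V(1)[OF assms(2)]] by (meson rtranclp.rtrancl_into_rtrancl)
  then show ?thesis
    using gate_eqI gate_props[OF assms(1) E_in_V(1)[OF assms(2)]] assms(1) by metis
qed

text \<open>The two gates are adjacent because \<open>B\<close> is a clique, which gives the upper
  bound. The lower bound is an induction on walks from \<open>u\<close>, removing the last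
  edge.\<close>

lemma gdist_via_gates:
  assumes B: "blk B" and V: "u \<in> V" "x \<in> V" and ne: "gate B u \<noteq> gate B x"
  shows "d u x = d u (gate B u) + 1 + d (gate B x) x"
proof (rule antisym)
  let ?gu = "gate B u" and ?gx = "gate B x"
  have g: "?gu \<in> V" "?gx \<in> V" using gate_in_V B V by auto
  have "d ?gu ?gx = 1" using gdist_adj blk_adj gate_props B V ne by metis
  moreover have "d u x \<le> d u ?gu + d ?gu x" "d ?gu x \<le> d ?gu ?gx + d ?gx x"
    using gdist_triangle V g by auto
  ultimately show "d u x \<le> d u ?gu + 1 + d ?gx x" by linarith
next
  have "d u (gate B u) + 1 + d (gate B x) x \<le> n" if "(E ^^ n) u x" "gate B u \<noteq> gate B x" for n x
    using that
  proof (induction n arbitrary: x)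
    case 0
    then show ?case by simp
  next
    case (Suc n)
    then obtain y where y: "(E ^^ n) u y" "E y x" by auto
    then have yx: "y \<in> V" "x \<in> V" using E_in_V by auto
    show ?case
    proof (cases "gate B y = gate B x")
      case True
      then have "d u (gate B u) + 1 + d (gate B x) y \<le> n" using Suc y by metis
      moreover have "d (gate B x) x \<le> d (gate B x) y + d y x"
        using gdist_triangle gate_in_V B yx by blast
      ultimately show ?thesis using gdist_adj y by fastforce
    next
      case False
      \<comment> \<open>The gate changes only along edges inside \<open>B\<close>, whose ends are
        their own gates.\<close>
      then have yxB: "y \<in> B" "x \<in> B" using gate_adj B y by blast+
      then have gs: "gate B y = y" "gate B x = x" using gate_self B by auto
      show ?thesis
      proof (cases "gate B u = y")
        case True
        then show ?thesis using gdist_le[OF y(1)] gs by simp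
      next
        case False
        then show ?thesis using Suc.IH[OF y(1)] gs by simp
      qed
    qed
  qed
  then show "d u (gate B u) + 1 + d (gate B x) x \<le> d u x"
    using gdist_walk V ne by blast
qed

lemma gdist_in_blk:
  assumes "blk B" "u \<in> B" "x \<in> V" "gate B x \<noteq> u"
  shows "d u x = 1 + d (gate B x) x"
  using gdist_via_gates[of B u x] assms gate_self blk_in_V by simp

text \<open>A vertex of \<open>C\<close> outside \<open>B\<close> would be joined to
  \<open>a\<close> and to \<open>b\<close> by edges not inside \<open>B\<close>, and so would have
  both as its gate.\<close>

lemma blk_inter:
  assumes B: "blk B" and C: "blk C" and ne: "B \<noteq> C" and "a \<in> B" "a \<in> C" "b \<in> B" "b \<in> C"
  shows "a = b"
proof (rule ccontr)
  assume "a \<noteq> b"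
  have "\<not> C \<subset> B" using B C unfolding is_block_def by blast
  then obtain c where c: "c \<in> C" "c \<notin> B" using ne by blast
  then have "gate B a = gate B c" "gate B b = gate B c"
    using gate_adj[OF B] blk_adj[OF C] assms by metis+
  then show False using gate_self[OF B] assms \<open>a \<noteq> b\<close> by metis
qed

lemma gate_const_on_blk:
  assumes "blk B" "blk C" "B \<noteq> C" "c \<in> C" "c' \<in> C"
  shows "gate B c = gate B c'"
proof (cases "c = c'")
  case False
  then show ?thesis
    using gate_adj[of B c c'] blk_adj[of C c c'] blk_inter[of B C c c'] assms by blast
qed auto

text \<open>If \<open>C\<close> is a second block at \<open>v\<close>, its vertices have gate
  \<open>v\<close> in \<open>B\<close>, and no walk avoiding \<open>v\<close> can change that. If
  \<open>B\<close> is the only block at \<open>v\<close>, all neighbours of \<open>v\<close> lie in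
  the clique \<open>B\<close>, so walks can bypass \<open>v\<close>.\<close>

lemma cut_iff:
  assumes B: "blk B" and v: "v \<in> B"
  shows "cutv v \<longleftrightarrow> (\<exists>C. blk C \<and> C \<noteq> B \<and> v \<in> C)"
proof
  assume "\<exists>C. blk C \<and> C \<noteq> B \<and> v \<in> C"
  then obtain C where C: "blk C" "C \<noteq> B" "v \<in> C" by blast
  obtain u where u: "u \<in> B" "u \<noteq> v" using blk_other B by blast
  obtain u' where u': "u' \<in> C" "u' \<noteq> v" using blk_other C by blast
  have gu': "gate B u' = v" using gate_const_on_blk[OF B C(1)] C u' v gate_self[OF B] by metis
  have V: "u \<in> V" "u' \<in> V" using u u' B C blk_in_V by auto
  have "gate B x = v" if "(restr E (V - {v}))\<^sup>*\<^sup>* u' x" for x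
    using that
  proof induction
    case (step y z)
    then have "E y z" "y \<noteq> v" "z \<noteq> v" unfolding restr_def by auto
    then show ?case using step.IH gate_adj[OF B, of y z] gate_self[OF B, of y] by metis
  qed (use gu' in simp)
  then have "\<not> (restr E (V - {v}))\<^sup>*\<^sup>* u' u" using gate_self[OF B] u by metis
  then show "cutv v"
    unfolding cut_vertex_def connected_on_def using u u' V v blk_in_V[OF B] by blast
next
  assume "cutv v"
  show "\<exists>C. blk C \<and> C \<noteq> B \<and> v \<in> C"
  proof (rule ccontr)
    assume only: "\<not> ?thesis"
    have nb: "x \<in> B" if "E v x" for x
      using edge_in_blk[OF that] only by metis
    let ?S = "restr E (V - {v})"
    have "?S\<^sup>*\<^sup>* u x" if u: "u \<in> V - {v}" and x: "x \<in> V - {v}" for u x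
    proof -
      \<comment> \<open>When the walk stands at \<open>v\<close>, every vertex that it may visit
        next must already be reachable; all of these lie in \<open>B\<close>.\<close>
      have "if z = v then \<forall>y\<in>B - {v}. ?S\<^sup>*\<^sup>* u y else ?S\<^sup>*\<^sup>* u z" if "E\<^sup>*\<^sup>* u z" for z
        using that
      proof induction
        case base
        then show ?case using u by simp
      next
        case (step y z)
        have yz: "y \<in> V" "z \<in> V" using step E_in_V by auto
        consider "y = v" | "z = v" "y \<noteq> v" | "y \<noteq> v" "z \<noteq> v" by blast
        then show ?case
        proof cases
          case 1
          then show ?thesis using step nb E_neq by auto
        next
          case 2
          then have yB: "y \<in> B" "?S\<^sup>*\<^sup>* u y" using step nb E_sym by auto
          have "?S\<^sup>*\<^sup>* u t" if "t \<in> B - {v}" for t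
          proof (cases "t = y")
            case False
            then have "?S y t"
              using blk_adj[OF B, of y t] yB that 2 blk_in_V[OF B] unfolding restr_def by auto
            then show ?thesis using yB by (meson rtranclp.rtrancl_into_rtrancl)
          qed (use yB in simp)
          then show ?thesis using 2 by simp
        next
          case 3
          then have "?S y z" using step yz unfolding restr_def by auto
          then show ?thesis using 3 step.IH by (simp add: rtranclp.rtrancl_into_rtrancl)
        qed
      qed
      then show ?thesis using reach[of u x] u x by auto
    qed
    then show False using \<open>cutv v\<close> unfolding cut_vertex_def connected_on_def by blast
  qed
qed

lemma cut_in_V: "cutv v \<Longrightarrow> v \<in> V"
  unfolding cut_vertex_def by blast

lemma vertex_in_blk:
  assumes "v \<in> V" obtains B where "blk B" "v \<in> B"
  using exists_neighbour[OF assms] edge_in_blk by metis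

text \<open>Supplies the step away from \<open>B\<close>: the new vertex lies in a second block at
  \<open>w\<close>. Such steps from distinct vertices of \<open>B\<close> lead to nonadjacent
  vertices.\<close>

lemma cut_outer_neighbour:
  assumes B: "blk B" and "w \<in> B" "cutv w"
  obtains w' where "w' \<in> V" "E w w'" "gate B w' = w" "d w' w = 1"
proof -
  obtain C where C: "blk C" "C \<noteq> B" "w \<in> C" using cut_iff assms by blast
  obtain w' where w': "w' \<in> C" "w' \<noteq> w" using blk_other C by blast
  have "E w w'" using blk_adj C w' by metis
  moreover have "gate B w' = w"
    using gate_const_on_blk[OF B C(1)] C w' assms gate_self[OF B] by metis
  ultimately show ?thesis using that gdist_adj E_sym blk_in_V C w' by metis
qed

text \<open>The first edge of the \<open>off_edge\<close> walk from the gate to \<open>x\<close>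
  lies in a block other than \<open>B\<close>.\<close>

lemma gate_cut:
  assumes B: "blk B" and x: "x \<in> V" "x \<notin> B"
  shows "cutv (gate B x)"
proof -
  let ?w = "gate B x"
  have w: "?w \<in> B" "(off_edge B)\<^sup>*\<^sup>* ?w x" using gate_props assms by auto
  then have "?w \<noteq> x" using x by auto
  then obtain y where y: "off_edge B ?w y" using w by (metis converse_rtranclpE)
  then obtain C where "blk C" "?w \<in> C" "y \<in> C" using edge_in_blk unfolding off_edge_def by blast
  then show ?thesis using cut_iff[OF B w(1)] y w(1) unfolding off_edge_def by blast
qed

lemma gdist_outer:
  assumes B: "blk B" and "w \<in> B" "w' \<in> V" "gate B w' = w" "d w' w = 1" "x \<in> V" "gate B x \<noteq> w"
  shows "d w' x = 2 + d (gate B x) x"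
  using gdist_via_gates[OF B, of w' x] assms by simp

lemma nonadjacentI: "d u v \<ge> 2 \<Longrightarrow> u \<noteq> v \<and> \<not> E u v"
  using gdist_adj[of u v] by auto

section \<open>Distances in the block-cutpoint tree\<close>

abbreviation "bcV \<equiv> bc_vertices V E"
abbreviation "bcE \<equiv> bc_edge V E"

fun pts :: "'a set + 'a \<Rightarrow> 'a set" where
  "pts (Inl C) = C"
| "pts (Inr c) = {c}"

text \<open>The tree distance from a node to the cut-vertices among its \<open>pts\<close>; it is
  the constant offset between vertex and tree distances.\<close>

fun excess :: "'a set + 'a \<Rightarrow> nat" where
  "excess (Inl C) = 1"
| "excess (Inr c) = 0"

definition pdist :: "'a set + 'a \<Rightarrow> 'a \<Rightarrow> nat" where
  "pdist y v = Inf (d v ` pts y)"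

text \<open>By \<open>node_gate_eq\<close> the choice is immaterial for a node other than
  \<open>Inl B\<close>. The value tells in which branch at \<open>B\<close> the node lies.\<close>

definition node_gate :: "'a set \<Rightarrow> 'a set + 'a \<Rightarrow> 'a" where
  "node_gate B y = gate B (SOME c. c \<in> pts y)"

lemma bcV_iff [simp]: "Inl B \<in> bcV \<longleftrightarrow> blk B" "Inr v \<in> bcV \<longleftrightarrow> cutv v"
  unfolding bc_vertices_def by auto

lemma finite_bcV: "finite bcV"
proof -
  have "finite {B. blk B}" "finite {v. cutv v}"
    using finite_V blk_in_V cut_in_V
    by (auto intro: finite_subset[of _ "Pow V"] finite_subset[of _ V])
  then show ?thesis unfolding bc_vertices_def by simp
qed

lemma pts_nonempty: "y \<in> bcV \<Longrightarrow> pts y \<noteq> {}"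
  using blk_nonempty by (cases y) auto

lemma pts_in_V: "y \<in> bcV \<Longrightarrow> c \<in> pts y \<Longrightarrow> c \<in> V"
  using blk_in_V cut_in_V by (cases y) auto

lemma node_gate_eq:
  assumes B: "blk B" and y: "y \<in> bcV" "y \<noteq> Inl B" and c: "c \<in> pts y"
  shows "gate B c = node_gate B y"
proof -
  have *: "(SOME c. c \<in> pts y) \<in> pts y" using c by (rule someI)
  show ?thesis
  proof (cases y)
    case (Inl C)
    then have "blk C" "B \<noteq> C" using y by auto
    moreover have "c \<in> C" "(SOME c. c \<in> pts y) \<in> C" using c * unfolding Inl by simp_all
    ultimately show ?thesis unfolding node_gate_def by (rule gate_const_on_blk[OF B])
  qed (use c in \<open>simp add: node_gate_def\<close>)
qed

lemma node_gate_in: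
  assumes "blk B" "y \<in> bcV" "y \<noteq> Inl B"
  shows "node_gate B y \<in> B"
proof -
  obtain c where "c \<in> pts y" using pts_nonempty assms by blast
  then show ?thesis using node_gate_eq gate_props pts_in_V assms by metis
qed

lemma pdist_le: "c \<in> pts y \<Longrightarrow> pdist y v \<le> d v c"
  unfolding pdist_def by (simp add: cInf_lower)

lemma pdist_attained:
  assumes "y \<in> bcV" obtains c where "c \<in> pts y" "pdist y v = d v c"
  using pts_nonempty[OF assms] Inf_nat_def1[of "d v ` pts y"] that unfolding pdist_def by auto

lemma pdist_Inr [simp]: "pdist (Inr c) v = d v c"
  unfolding pdist_def by simp

lemma pdist_blk:
  assumes "blk B" "u \<in> V"
  shows "pdist (Inl B) u = d u (gate B u)"
proof (rule antisym)
  show "pdist (Inl B) u \<le> d u (gate B u)" using pdist_le gate_props assms by simp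
  obtain c where c: "c \<in> B" "pdist (Inl B) u = d u c"
    using pdist_attained[of "Inl B" u] assms by auto
  then show "d u (gate B u) \<le> pdist (Inl B) u"
    using gdist_via_gates[of B u c] assms gate_self blk_in_V by (cases "gate B u = c") auto
qed

lemma pdist_eq_0: "y \<in> bcV \<Longrightarrow> v \<in> V \<Longrightarrow> pdist y v = 0 \<longleftrightarrow> v \<in> pts y"
  by (metis gdist_eq_0 gdist_refl le_zero_eq pdist_attained pdist_le pts_in_V)

text \<open>In \<open>gdist_via_gates\<close> only the last term depends on the point of
  \<open>y\<close>, so the minimum can be taken there.\<close>

lemma pdist_via_gate:
  assumes B: "blk B" and y: "y \<in> bcV" "y \<noteq> Inl B" and u: "u \<in> V" "gate B u \<noteq> node_gate B y"
  shows "pdist y u = d u (gate B u) + 1 + pdist y (node_gate B y)"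
proof -
  have via: "d u c = d u (gate B u) + 1 + d (node_gate B y) c" if "c \<in> pts y" for c
    using gdist_via_gates[OF B, of u c] node_gate_eq[OF B y that] u pts_in_V[OF y(1) that] by simp
  obtain c c' where "c \<in> pts y" "pdist y u = d u c"
    "c' \<in> pts y" "pdist y (node_gate B y) = d (node_gate B y) c'"
    using pdist_attained[OF y(1)] by metis
  then show ?thesis
    using via[of c] via[of c'] pdist_le[of c y "node_gate B y"] pdist_le[of c' y u] by linarith
qed

lemma pdist_in_blk:
  assumes "blk B" "y \<in> bcV" "y \<noteq> Inl B" "u \<in> B" "u \<noteq> node_gate B y"
  shows "pdist y u = 1 + pdist y (node_gate B y)"
  using pdist_via_gate[of B y u] assms gate_self[of B u] blk_in_V[of B u] by simp

text \<open>Closed form of the tree distance, with the target as first argument. From a block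
  \<open>B\<close> other than the target, the path starts with the cut-vertex
  \<open>node_gate B y\<close>, hence the extra 1.\<close>

fun bcdist :: "'a set + 'a \<Rightarrow> 'a set + 'a \<Rightarrow> nat" where
  "bcdist y (Inr v) = 2 * pdist y v + excess y"
| "bcdist y (Inl B) = (if y = Inl B then 0 else 2 * pdist y (node_gate B y) + 1 + excess y)"

text \<open>For \<open>y\<close> other than \<open>Inl B\<close>, the gate towards \<open>y\<close>
  has value one less than the block, and the other vertices of \<open>B\<close> have value one
  more.\<close>

lemma bcdist_edge:
  assumes "y \<in> bcV" "blk B" "v \<in> B"
  shows "bcdist y (Inl B) \<le> bcdist y (Inr v) + 1" "bcdist y (Inr v) \<le> bcdist y (Inl B) + 1"
  using pdist_in_blk[of B y v] pdist_eq_0[of y v] blk_in_V[of B v] assms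
  by (cases "y = Inl B"; cases "v = node_gate B y"; simp)+

text \<open>In the descent, a block moves to its gate towards \<open>y\<close>, and a cut-vertex to
  the block containing the first edge of a geodesic to \<open>y\<close>.\<close>

lemma gdist_bc:
  assumes y: "y \<in> bcV" and "z \<in> bcV"
  shows "gdist bcE z y = bcdist y z"
proof (rule gdist_eqI[where P = "\<lambda>z. z \<in> bcV"])
  show "bcdist y y = 0" by (cases y) auto
next
  fix a b assume "bcE a b"
  then show "bcdist y a \<le> bcdist y b + 1"
    unfolding bc_edge_def using bcdist_edge[OF y] by blast
next
  fix a assume a: "a \<in> bcV" "a \<noteq> y"
  show "\<exists>b. bcE a b \<and> b \<in> bcV \<and> bcdist y a = bcdist y b + 1"
  proof (cases a)
    case (Inl B)
    then have B: "blk B" "y \<noteq> Inl B" using a by auto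
    let ?w = "node_gate B y"
    have w: "?w \<in> B" using node_gate_in B y by blast
    \<comment> \<open>If \<open>y\<close> has a point outside \<open>B\<close>,
      \<open>gate_cut\<close> applies. Otherwise maximality of blocks leaves only a cut-vertex in
      \<open>B\<close>, which is its own gate.\<close>
    have "cutv ?w"
    proof (cases "\<exists>c\<in>pts y. c \<notin> B")
      case True
      then show ?thesis using gate_cut[OF B(1)] node_gate_eq[OF B(1) y B(2)] pts_in_V[OF y] by metis
    next
      case False
      then have sub: "pts y \<subseteq> B" by blast
      show ?thesis
      proof (cases y)
        case (Inl C)
        then have "blk C" "C \<subset> B" using y sub B by auto
        then show ?thesis using B unfolding is_block_def by blast
      next
        case (Inr c)
        then show ?thesis using node_gate_eq[OF B(1) y B(2), of c] gate_self[OF B(1), of c] sub y by auto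
      qed
    qed
    moreover have "bcE a (Inr ?w)" unfolding bc_edge_def using Inl B w \<open>cutv ?w\<close> by blast
    ultimately show ?thesis using Inl B by (intro exI[of _ "Inr ?w"]) simp
  next
    case (Inr v)
    then have v: "cutv v" "v \<in> V" using a cut_in_V by auto
    show ?thesis
    proof (cases "v \<in> pts y")
      case True
      then obtain C where C: "y = Inl C" using Inr a by (cases y) auto
      then have "bcE a y" unfolding bc_edge_def using Inr v True y by auto
      moreover have "pdist y v = 0" using pdist_eq_0 True y v by blast
      ultimately show ?thesis using Inr C y by (intro exI[of _ y]) simp
    next
      case False
      obtain c where c: "c \<in> pts y" "pdist y v = d v c" using pdist_attained y by blast
      then have "v \<noteq> c" "c \<in> V" using False pts_in_V y by auto
      then obtain v' where v': "E v v'" "d v c = d v' c + 1" using gdist_step v by metis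
      then have less: "pdist y v' < pdist y v" using pdist_le[OF c(1), of v'] c by simp
      obtain B where B: "blk B" "v \<in> B" "v' \<in> B" using edge_in_blk v' by metis
      have ne: "y \<noteq> Inl B" using False B by auto
      \<comment> \<open>The gate is strictly closer to \<open>y\<close> than every other vertex of
        \<open>B\<close>, but \<open>v'\<close> is closer than \<open>v\<close>.\<close>
      have "v \<noteq> node_gate B y"
        using less pdist_in_blk[OF B(1) y ne B(3)] by (cases "v' = node_gate B y") auto
      then have "pdist y v = 1 + pdist y (node_gate B y)" using pdist_in_blk[OF B(1) y ne B(2)] by blast
      moreover have "bcE a (Inl B)" unfolding bc_edge_def using Inr B v by blast
      ultimately show ?thesis using Inr B ne by (intro exI[of _ "Inl B"]) simp
    qed
  qed
qed (use assms in auto)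

lemma resolves_bc:
  assumes "Y \<subseteq> bcV" "a \<in> bcV" "b \<in> bcV"
  shows "resolves bcE Y a b \<longleftrightarrow> (\<exists>y\<in>Y. bcdist y a \<noteq> bcdist y b)"
  unfolding resolves_def using gdist_bc assms by (metis subsetD)

text \<open>The gate of \<open>u\<close> differs from \<open>x\<close>: it is a cut-vertex if
  \<open>u\<close> is outside \<open>B\<close>, and it is \<open>u\<close> itself otherwise.\<close>

lemma gdist_noncut:
  assumes "blk B" "x \<in> B" "\<not> cutv x" "u \<in> V" "u \<noteq> x"
  shows "d u x = pdist (Inl B) u + 1"
proof -
  have "gate B u \<noteq> x"
    using gate_cut[of B u] gate_self[of B u] assms by metis
  then show ?thesis
    using gdist_via_gates[of B u x] pdist_blk gate_self[of B x] blk_in_V[of B x] assms by simp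
qed

section \<open>From nonlocal resolving sets to resolving sets of the tree\<close>

text \<open>A vertex of \<open>V\<close> that is not a cut-vertex lies in exactly one block by
  \<open>cut_iff\<close>, so the choice is forced.\<close>

definition project :: "'a \<Rightarrow> 'a set + 'a" where
  "project x = (if cutv x then Inr x else Inl (SOME B. blk B \<and> x \<in> B))"

lemma project_noncut:
  assumes "x \<in> V" "\<not> cutv x"
  obtains B where "project x = Inl B" "blk B" "x \<in> B"
proof -
  have "\<exists>B. blk B \<and> x \<in> B" using vertex_in_blk[OF assms(1)] by metis
  then have "blk (SOME B. blk B \<and> x \<in> B) \<and> x \<in> (SOME B. blk B \<and> x \<in> B)" by (rule someI_ex)
  then show ?thesis using that assms unfolding project_def by auto
qed

lemma project_props:
  assumes "x \<in> V"
  shows "project x \<in> bcV" "x \<in> pts (project x)"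
proof -
  have "project x \<in> bcV \<and> x \<in> pts (project x)"
  proof (cases "cutv x")
    case True
    then show ?thesis unfolding project_def by simp
  next
    case False
    then obtain B where "project x = Inl B" "blk B" "x \<in> B" using project_noncut assms by blast
    then show ?thesis by simp
  qed
  then show "project x \<in> bcV" "x \<in> pts (project x)" by auto
qed

text \<open>The excluded case is a vertex that is not a cut-vertex, compared with itself: its
  distance is 0 while the excess is 1.\<close>

lemma gdist_project:
  assumes "x \<in> V" "u \<in> V" "cutv x \<or> u \<noteq> x"
  shows "d u x = pdist (project x) u + excess (project x)"
proof (cases "cutv x")
  case True
  then show ?thesis unfolding project_def by simp
next
  case False
  then obtain B where "project x = Inl B" "blk B" "x \<in> B" using project_noncut assms by blast
  then show ?thesis using gdist_noncut[of B x u] False assms by simp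
qed

context
  fixes X assumes X: "nonlocal_resolving_set V E X"
begin

lemma nonlocal_resolved:
  assumes "u \<in> V" "v \<in> V" "d u v \<ge> 2"
  obtains x where "x \<in> X" "x \<in> V" "d u x \<noteq> d v x"
  using X nonadjacentI[OF assms(3)] assms that
  unfolding nonlocal_resolving_set_def resolves_def by blast

text \<open>An unresolved pair is adjacent, hence in a common block. A landmark that resolves outer
  neighbours of \<open>u\<close> and \<open>v\<close> must have gate \<open>u\<close> or
  \<open>v\<close>, but then it resolves \<open>u\<close> and \<open>v\<close>.\<close>

lemma project_resolves_cuts:
  assumes u: "cutv u" and v: "cutv v" and "u \<noteq> v"
  shows "\<exists>x\<in>X. pdist (project x) u \<noteq> pdist (project x) v"
proof (rule ccontr)
  assume unresolved: "\<not> ?thesis"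
  have eq: "d u x = d v x" if "x \<in> X" for x
  proof -
    have "x \<in> V" "cutv x \<or> u \<noteq> x" "cutv x \<or> v \<noteq> x"
      using that X u v unfolding nonlocal_resolving_set_def by auto
    then show ?thesis
      using gdist_project[of x u] gdist_project[of x v] u v cut_in_V that unresolved by auto
  qed
  have V: "u \<in> V" "v \<in> V" using u v cut_in_V by auto
  then have "E u v"
    using X \<open>u \<noteq> v\<close> eq unfolding nonlocal_resolving_set_def resolves_def by blast
  then obtain B where B: "blk B" "u \<in> B" "v \<in> B" using edge_in_blk by metis
  obtain u' where u': "u' \<in> V" "E u u'" "gate B u' = u" "d u' u = 1" using cut_outer_neighbour B u by metis
  obtain v' where v': "v' \<in> V" "E v v'" "gate B v' = v" "d v' v = 1" using cut_outer_neighbour B v by metis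
  have "d u' v' \<ge> 2"
    using gdist_outer[OF B(1) B(2), of u' v'] u' v' \<open>u \<noteq> v\<close> by simp
  from nonlocal_resolved[OF u'(1) v'(1) this]
  obtain x where x: "x \<in> X" "x \<in> V" "d u' x \<noteq> d v' x" .
  have "d v x \<noteq> 1 + d u x" "d u x \<noteq> 1 + d v x" using eq[OF x(1)] by simp_all
  then have "gate B x \<noteq> u" "gate B x \<noteq> v"
    using gdist_in_blk[OF B(1) B(2) x(2)] gdist_in_blk[OF B(1) B(3) x(2)] \<open>u \<noteq> v\<close> by metis+
  then show False
    using gdist_outer[OF B(1) B(2), of u' x] gdist_outer[OF B(1) B(3), of v' x] u' v' x by simp
qed

text \<open>Choose \<open>u\<close> in \<open>B\<close> off the gate \<open>p\<close> of
  \<open>C\<close>, and \<open>v\<close> in \<open>C\<close> off the gate \<open>q\<close> of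
  \<open>B\<close>. A landmark not separating the two blocks is equidistant from them and reaches
  them through \<open>p\<close> and \<open>q\<close>, so it is equidistant from \<open>u\<close> and
  \<open>v\<close>.\<close>

lemma project_resolves_blks:
  assumes B: "blk B" and C: "blk C" and ne: "B \<noteq> C"
  shows "\<exists>x\<in>X. bcdist (project x) (Inl B) \<noteq> bcdist (project x) (Inl C)"
proof (rule ccontr)
  assume "\<not> ?thesis"
  then have eq: "bcdist (project x) (Inl B) = bcdist (project x) (Inl C)" if "x \<in> X" for x
    using that by blast
  obtain b0 c0 where "b0 \<in> B" "c0 \<in> C" using blk_nonempty B C by blast
  define p q where "p = gate B c0" and "q = gate C b0"
  have gB: "gate B c = p" if "c \<in> C" for c
    using gate_const_on_blk[OF B C ne that \<open>c0 \<in> C\<close>] unfolding p_def .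
  have gC: "gate C b = q" if "b \<in> B" for b
    using gate_const_on_blk[OF C B ne[symmetric] that \<open>b0 \<in> B\<close>] unfolding q_def .
  have pq: "p \<in> B" "q \<in> C"
    using gate_props B C blk_in_V \<open>b0 \<in> B\<close> \<open>c0 \<in> C\<close> unfolding p_def q_def by metis+
  obtain u where u: "u \<in> B" "u \<noteq> p" using blk_other B by blast
  obtain v where v: "v \<in> C" "v \<noteq> q" using blk_other C by blast
  have V: "u \<in> V" "v \<in> V" "p \<in> V" "q \<in> V" using u v pq blk_in_V B C by auto
  have "p \<noteq> v" using gC[OF pq(1)] gate_self[OF C v(1)] v by metis
  then have "d p v \<noteq> 0" using gdist_eq_0 V by blast
  moreover have "d u v = 1 + d p v" using gdist_in_blk[OF B u(1) V(2)] gB v u by simp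
  ultimately have "d u v \<ge> 2" by simp
  from nonlocal_resolved[OF V(1,2) this]
  obtain x where x: "x \<in> X" "x \<in> V" "d u x \<noteq> d v x" .
  let ?y = "project x"
  have y: "?y \<in> bcV" "x \<in> pts ?y" using project_props x by auto
  \<comment> \<open>The value 0 is taken only at the node itself, and \<open>B\<close> and
    \<open>C\<close> differ.\<close>
  have yBC: "?y \<noteq> Inl B" "?y \<noteq> Inl C" using eq[OF x(1)] ne by (force split: if_splits)+
  \<comment> \<open>Rules out the excluded case of \<open>gdist_project\<close> for the two
    gates.\<close>
  have notin: "gate D x \<noteq> x \<or> cutv x" if D: "blk D" "?y \<noteq> Inl D" for D
  proof (rule ccontr)
    assume "\<not> ?thesis"
    then have x': "gate D x = x" "\<not> cutv x" by auto
    then have "x \<in> D" using gate_props[OF D(1) x(2)] by simp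
    moreover obtain D' where "?y = Inl D'" "blk D'" "x \<in> D'" using project_noncut x x' by metis
    ultimately show False using cut_iff[of D x] D x' by blast
  qed
  have m: "d (gate B x) x = d (gate C x) x"
    using gdist_project[OF x(2), of "gate B x"] gdist_project[OF x(2), of "gate C x"]
      notin[OF B yBC(1)] notin[OF C yBC(2)] gate_in_V[OF B x(2)] gate_in_V[OF C x(2)] eq[OF x(1)] yBC
      node_gate_eq[OF B y(1) yBC(1) y(2)] node_gate_eq[OF C y(1) yBC(2) y(2)] by auto
  have g: "gate B x \<in> B" "gate C x \<in> C" using gate_props B C x by auto
  have "gate C x = q \<Longrightarrow> gate B x = p"
    using gdist_via_gates[OF B, of q x] gB[OF pq(2)] V x(2) m by fastforce
  \<comment> \<open>Otherwise the way from \<open>gate B x\<close> to \<open>x\<close> would cross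
    \<open>C\<close>, making \<open>x\<close> farther from \<open>B\<close> than from
    \<open>C\<close>.\<close>
  moreover have "gate C x = q"
  proof (rule ccontr)
    assume "gate C x \<noteq> q"
    then show False
      using gdist_via_gates[OF C, of "gate B x" x] gC[OF g(1)] blk_in_V[OF B g(1)] x(2) m by fastforce
  qed
  ultimately have "d u x = d v x"
    using gdist_in_blk[OF B u(1) x(2)] gdist_in_blk[OF C v(1) x(2)] u v m by simp
  then show False using x by simp
qed

text \<open>By parity any landmark works, and \<open>X\<close> is nonempty because some two vertices
  are at distance at least 2.\<close>

lemma project_resolves_mixed:
  assumes B: "blk B" and v: "cutv v"
  shows "\<exists>x\<in>X. bcdist (project x) (Inl B) \<noteq> bcdist (project x) (Inr v)"
proof -
  obtain C where C: "blk C" "v \<in> C" using vertex_in_blk cut_in_V v by metis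
  obtain v' where v': "v' \<in> V" "gate C v' = v" "d v' v = 1" using cut_outer_neighbour C v by metis
  obtain w where w: "w \<in> C" "w \<noteq> v" using blk_other C by metis
  have "w \<in> V" using w C blk_in_V by blast
  moreover have "d v' w \<ge> 2"
    using gdist_outer[OF C(1) C(2) v' \<open>w \<in> V\<close>] gate_self[OF C(1) w(1)] w by simp
  ultimately obtain x where x: "x \<in> X" using nonlocal_resolved[OF v'(1)] by metis
  have "even (bcdist y (Inl B)) \<noteq> even (bcdist y (Inr v))" for y
    by (cases y) auto
  then show ?thesis using x by metis
qed

lemma project_resolving: "resolving_set bcV bcE (project ` X)"
proof -
  have sub: "project ` X \<subseteq> bcV"
    using X project_props unfolding nonlocal_resolving_set_def by auto
  have "\<exists>x\<in>X. bcdist (project x) a \<noteq> bcdist (project x) b"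
    if "a \<in> bcV" "b \<in> bcV" "a \<noteq> b" for a b
  proof (cases a)
    case (Inl B)
    then show ?thesis using that project_resolves_blks[of B] project_resolves_mixed[of B]
      by (cases b) auto
  next
    case (Inr u)
    then have "cutv u" using that by simp
    show ?thesis
    proof (cases b)
      case (Inl B)
      then have "blk B" using that by simp
      then show ?thesis
        using project_resolves_mixed[of B u] \<open>cutv u\<close> unfolding \<open>a = Inr u\<close> Inl by metis
    next
      case (Inr v)
      then show ?thesis using project_resolves_cuts[of u v] that \<open>a = Inr u\<close> by auto
    qed
  qed
  then show ?thesis
    unfolding resolving_set_def using sub resolves_bc[OF sub] by (auto simp del: bcdist.simps)
qed

end

section \<open>From resolving sets of the tree to nonlocal resolving sets\<close>

text \<open>Take the block of the first edge of a geodesic from \<open>u\<close> to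
  \<open>v\<close>; its second vertex is closer to \<open>v\<close> than \<open>u\<close>
  is.\<close>

lemma exit_blk:
  assumes "u \<in> V" "v \<in> V" "u \<noteq> v"
  obtains B where "blk B" "u \<in> B" "gate B v \<noteq> u"
proof -
  obtain w where w: "E u w" "d u v = d w v + 1" using gdist_step assms by metis
  then obtain B where B: "blk B" "u \<in> B" "w \<in> B" using edge_in_blk by metis
  have "d w v \<noteq> 1 + d u v" using w by linarith
  then have "gate B v \<noteq> u"
    using gdist_in_blk[OF B(1) B(3) assms(2)] E_neq[OF w(1)] by metis
  then show ?thesis using that B by blast
qed

text \<open>The way from \<open>v\<close> to \<open>y\<close> must cross \<open>B\<close> and pass
  through \<open>u\<close>.\<close>

lemma pdist_beyond:
  assumes B: "blk B" and u: "u \<in> B" and v: "v \<in> V" "gate B v \<noteq> u"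
    and y: "y \<in> bcV" "y \<noteq> Inl B" and g: "node_gate B y = u"
  shows "pdist y u < pdist y v"
  using pdist_via_gate[OF B y v(1)] v g by simp

context
  fixes Y assumes Y: "resolving_set bcV bcE Y"
begin

lemma Y_in: "y \<in> Y \<Longrightarrow> y \<in> bcV"
  using Y unfolding resolving_set_def by blast

text \<open>Let \<open>B\<close> and \<open>C\<close> be the blocks by which \<open>u\<close> and
  \<open>v\<close> are left towards each other. By \<open>pdist_beyond\<close> a landmark that does
  not separate \<open>u\<close> and \<open>v\<close> lies behind neither, so both steps approach it
  by 1, and \<open>B\<close> and \<open>C\<close> are not separated either.\<close>

lemma pdist_resolves_nonlocal:
  assumes u: "u \<in> V" and v: "v \<in> V" and "u \<noteq> v" "\<not> E u v"
  shows "\<exists>y\<in>Y. pdist y u \<noteq> pdist y v"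
proof (rule ccontr)
  assume "\<not> ?thesis"
  then have eq: "pdist y u = pdist y v" if "y \<in> Y" for y using that by blast
  obtain B where B: "blk B" "u \<in> B" "gate B v \<noteq> u" using exit_blk assms by metis
  obtain C where C: "blk C" "v \<in> C" "gate C u \<noteq> v" using exit_blk assms by metis
  have vB: "v \<notin> B" and uC: "u \<notin> C"
    using blk_adj[OF B(1), of u v] blk_adj[OF C(1), of u v] assms B C by auto
  have "bcdist y (Inl B) = bcdist y (Inl C)" if "y \<in> Y" for y
  proof -
    have y: "y \<in> bcV" using Y_in that by blast
    have "u \<in> pts y \<longleftrightarrow> v \<in> pts y" using pdist_eq_0[OF y] u v eq[OF that] by metis
    \<comment> \<open>A block containing one of \<open>u\<close>, \<open>v\<close> but not the other
      would be at distance 0 from just one of them.\<close>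
    then have ne: "y \<noteq> Inl B" "y \<noteq> Inl C" using vB uC B C by auto
    have "node_gate B y \<noteq> u" "node_gate C y \<noteq> v"
      using pdist_beyond[OF B(1,2) v B(3) y ne(1)] pdist_beyond[OF C(1,2) u C(3) y ne(2)] eq[OF that]
      by auto
    then have "pdist y u = 1 + pdist y (node_gate B y)" "pdist y v = 1 + pdist y (node_gate C y)"
      using pdist_in_blk[OF B(1) y ne(1) B(2)] pdist_in_blk[OF C(1) y ne(2) C(2)] by auto
    then show ?thesis using eq[OF that] ne by simp
  qed
  moreover have "Inl B \<in> bcV" "Inl C \<in> bcV" "Inl B \<noteq> (Inl C :: 'a set + 'a)" using B C vB by auto
  ultimately show False
    using Y resolves_bc[of Y "Inl B" "Inl C"] unfolding resolving_set_def by blast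
qed

section \<open>Lifting landmarks of the tree to vertices\<close>

definition free_branch :: "'a set \<Rightarrow> 'a \<Rightarrow> bool" where
  "free_branch B w \<longleftrightarrow> w \<in> B \<and> (\<forall>y\<in>Y - {Inl B}. node_gate B y \<noteq> w)"

text \<open>Outer neighbours of \<open>w1\<close> and \<open>w2\<close> would be nonadjacent and
  equidistant from every landmark: from \<open>Inl B\<close>, and from all others through gates
  different from \<open>w1\<close> and \<open>w2\<close>.\<close>

lemma free_branch_unique:
  assumes B: "blk B" and cuts: "\<forall>w\<in>B. cutv w" and w: "free_branch B w1" "free_branch B w2"
  shows "w1 = w2"
proof (rule ccontr)
  assume ne: "w1 \<noteq> w2"
  have wB: "w1 \<in> B" "w2 \<in> B" using w unfolding free_branch_def by auto
  obtain v1 where v1: "v1 \<in> V" "gate B v1 = w1" "d v1 w1 = 1"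
    using cut_outer_neighbour B wB cuts by metis
  obtain v2 where v2: "v2 \<in> V" "gate B v2 = w2" "d v2 w2 = 1"
    using cut_outer_neighbour B wB cuts by metis
  have "d v1 v2 \<ge> 2" using gdist_outer[OF B wB(1) v1 v2(1)] v2 ne by simp
  then obtain y where y: "y \<in> Y" "pdist y v1 \<noteq> pdist y v2"
    using pdist_resolves_nonlocal nonadjacentI v1 v2 by metis
  show False
  proof (cases "y = Inl B")
    case True
    then show ?thesis using y pdist_blk[OF B] v1 v2 by simp
  next
    case False
    then have "node_gate B y \<noteq> w1" "node_gate B y \<noteq> w2"
      using w y unfolding free_branch_def by auto
    then show ?thesis
      using pdist_via_gate[OF B Y_in[OF y(1)] False, of v1] v1
        pdist_via_gate[OF B Y_in[OF y(1)] False, of v2] v2 y by simp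
  qed
qed

text \<open>A block is represented by a private vertex if it has one, and otherwise by its vertex
  whose branch contains no other landmark, so that every branch then contains a landmark.\<close>

fun lift :: "'a set + 'a \<Rightarrow> 'a" where
  "lift (Inr c) = c"
| "lift (Inl B) =
    (if \<exists>x\<in>B. \<not> cutv x then SOME x. x \<in> B \<and> \<not> cutv x
     else if \<exists>w. free_branch B w then SOME w. free_branch B w
     else SOME w. w \<in> B)"

lemma lift_in_pts:
  assumes "y \<in> bcV"
  shows "lift y \<in> pts y"
proof (cases y)
  case (Inl B)
  consider "\<exists>x\<in>B. \<not> cutv x" | "\<not> (\<exists>x\<in>B. \<not> cutv x)" "\<exists>w. free_branch B w"
    | "\<not> (\<exists>x\<in>B. \<not> cutv x)" "\<not> (\<exists>w. free_branch B w)"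
    by blast
  then show ?thesis
  proof cases
    case 1
    then have "\<exists>x. x \<in> B \<and> \<not> cutv x" by blast
    from someI_ex[OF this] show ?thesis using Inl 1 by simp
  next
    case 2
    from someI_ex[OF 2(2)] have "(SOME w. free_branch B w) \<in> B" unfolding free_branch_def by blast
    moreover have "lift y = (SOME w. free_branch B w)" using Inl 2 by simp
    ultimately show ?thesis using Inl by simp
  next
    case 3
    have "\<exists>w. w \<in> B" using pts_nonempty[OF assms] Inl by auto
    from someI_ex[OF this] show ?thesis using Inl 3 by auto
  qed
qed simp

text \<open>A free branch is unique, so \<open>Inl B\<close> is lifted into it. Any other branch
  contains a landmark, whose lift stays in that branch.\<close>

lemma lift_hits_branch:
  assumes B: "Inl B \<in> Y" and cuts: "\<forall>w\<in>B. cutv w" and w: "w \<in> B"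
  shows "\<exists>x\<in>lift ` Y. gate B x = w"
proof (cases "free_branch B w")
  case True
  have B': "blk B" using Y_in[OF B] by simp
  have "free_branch B (SOME w. free_branch B w)" using True by (rule someI)
  then have "lift (Inl B) = w"
    using free_branch_unique[OF B' cuts _ True] True cuts by auto
  then show ?thesis using B gate_self[OF B' w] by blast
next
  case False
  then obtain y where y: "y \<in> Y" "y \<noteq> Inl B" "node_gate B y = w"
    using w unfolding free_branch_def by blast
  have "gate B (lift y) = w"
    using node_gate_eq[of B y "lift y"] lift_in_pts Y_in[OF y(1)] y Y_in[OF B] by simp
  then show ?thesis using y by blast
qed

text \<open>The direction of the inequality matters for a block consisting of cut-vertices: the
  landmark is chosen outside the branch of the farther vertex \<open>v\<close>.\<close>

lemma lift_resolves_of_less: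
  assumes "y \<in> Y" and u: "u \<in> V" and v: "v \<in> V" and less: "pdist y u < pdist y v"
  shows "\<exists>x\<in>lift ` Y. d u x \<noteq> d v x"
proof (cases y)
  case (Inr c)
  then have "lift y = c" "d u c \<noteq> d v c" using less by auto
  then show ?thesis using assms(1) by blast
next
  case (Inl B)
  then have B: "blk B" using Y_in[OF assms(1)] by simp
  show ?thesis
  proof (cases "\<exists>x\<in>B. \<not> cutv x")
    case True
    then have "\<exists>x. x \<in> B \<and> \<not> cutv x" by blast
    from someI_ex[OF this] have x: "lift y \<in> B" "\<not> cutv (lift y)" using Inl True by auto
    have "u \<noteq> v" using less by auto
    \<comment> \<open>Distances to the private vertex are \<open>pdist\<close> plus 1, except from
      that vertex itself, where the distance is 0.\<close>
    then have "d u (lift y) \<noteq> d v (lift y)"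
      using gdist_noncut[OF B x u] gdist_noncut[OF B x v] less Inl gdist_eq_0[OF u v]
        gdist_eq_0[OF v u]
      by (cases "u = lift y"; cases "v = lift y") auto
    then show ?thesis using assms(1) by blast
  next
    case False
    \<comment> \<open>With \<open>w\<close> different from the gate of \<open>v\<close>, the
      distance from \<open>v\<close> is exact, while the triangle inequality bounds the one from
      \<open>u\<close> by a smaller number.\<close>
    obtain w where w: "w \<in> B" "w \<noteq> gate B v" using blk_other B by blast
    then obtain x where x: "x \<in> lift ` Y" "gate B x = w"
      using lift_hits_branch[of B w] False assms(1) Inl by auto
    have xV: "x \<in> V" using x lift_in_pts Y_in pts_in_V by auto
    have gV: "gate B u \<in> V" "w \<in> V" using gate_in_V B u w blk_in_V by auto
    have "d (gate B u) w \<le> 1"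
      using gdist_adj[of "gate B u" w] blk_adj[OF B, of "gate B u" w] gate_props[OF B u] w
      by (cases "gate B u = w") auto
    then have "d u x \<le> d u (gate B u) + 1 + d w x"
      using gdist_triangle[OF u gV(1) xV] gdist_triangle[OF gV xV] by linarith
    moreover have "d v x = d v (gate B v) + 1 + d w x"
      using gdist_via_gates[OF B v xV] x w by simp
    ultimately show ?thesis using less Inl pdist_blk[OF B] u v x by (intro bexI[of _ x]) auto
  qed
qed

lemma lift_resolving: "\<exists>X. nonlocal_resolving_set V E X \<and> card X \<le> card Y"
proof (intro exI conjI)
  have "lift ` Y \<subseteq> V" using lift_in_pts Y_in pts_in_V by blast
  moreover have "resolves E (lift ` Y) u v" if uv: "u \<in> V" "v \<in> V" "u \<noteq> v" "\<not> E u v" for u v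
  proof -
    obtain y where "y \<in> Y" "pdist y u \<noteq> pdist y v" using pdist_resolves_nonlocal uv by metis
    then show ?thesis
      using lift_resolves_of_less[of y u v] lift_resolves_of_less[of y v u] uv
      unfolding resolves_def by (metis nat_neq_iff)
  qed
  ultimately show "nonlocal_resolving_set V E (lift ` Y)"
    unfolding nonlocal_resolving_set_def by blast
  have "Y \<subseteq> bcV" using Y_in by blast
  then show "card (lift ` Y) \<le> card Y"
    using card_image_le finite_subset[OF _ finite_bcV] by blast
qed

end

end

section \<open>Attainment of the minima, and equality of the dimensions\<close>

lemma metric_dim_attained:
  assumes "resolving_set V E X"
  obtains Y where "resolving_set V E Y" "card Y = metric_dim V E"
proof -
  have "\<exists>k Y. resolving_set V E Y \<and> card Y = k" using assms by blast
  from LeastI_ex[OF this] show ?thesis using that unfolding metric_dim_def by blast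
qed

lemma nonlocal_metric_dim_attained:
  assumes "nonlocal_resolving_set V E X"
  obtains Y where "nonlocal_resolving_set V E Y" "card Y = nonlocal_metric_dim V E"
proof -
  have "\<exists>k Y. nonlocal_resolving_set V E Y \<and> card Y = k" using assms by blast
  from LeastI_ex[OF this] show ?thesis using that unfolding nonlocal_metric_dim_def by blast
qed

theorem theorem3p1:
  fixes V :: "'a set" and E :: "'a \<Rightarrow> 'a \<Rightarrow> bool"
  assumes "block_graph V E"
    and "card V \<ge> 3"
  shows "nonlocal_metric_dim V E = metric_dim (bc_vertices V E) (bc_edge V E)"
proof -
  interpret nontrivial_block_graph V E
    using assms by unfold_locales auto
  \<comment> \<open>\<open>V\<close> and its projection witness that both minima range over nonempty
    sets.\<close>
  have all: "nonlocal_resolving_set V E V"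
    unfolding nonlocal_resolving_set_def resolves_def using gdist_eq_0 by force
  show ?thesis
  proof (rule antisym)
    obtain Y where Y: "resolving_set bcV bcE Y" "card Y = metric_dim bcV bcE"
      using metric_dim_attained project_resolving[OF all] by blast
    then obtain X where X: "nonlocal_resolving_set V E X" "card X \<le> card Y"
      using lift_resolving by blast
    have "nonlocal_metric_dim V E \<le> card X"
      unfolding nonlocal_metric_dim_def using X by (intro Least_le) blast
    then show "nonlocal_metric_dim V E \<le> metric_dim bcV bcE"
      using X Y by simp
  next
    obtain X where X: "nonlocal_resolving_set V E X" "card X = nonlocal_metric_dim V E"
      using nonlocal_metric_dim_attained all by blast
    have "finite X" using X(1) finite_V finite_subset unfolding nonlocal_resolving_set_def by blast
    then have "card (project ` X) \<le> card X" by (rule card_image_le)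
    moreover have "metric_dim bcV bcE \<le> card (project ` X)"
      unfolding metric_dim_def using project_resolving[OF X(1)] by (intro Least_le) blast
    ultimately show "metric_dim bcV bcE \<le> nonlocal_metric_dim V E"
      using X by simp
  qed
qed

end
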